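(* Let $p$ be a prime, let $G$ be a finite additive abelian $p$-group, and let $h\in\{0,1,2,\ldots\}$. Let $A=\{a_s(n_s)\}_{s=1}^k$ (with $a_s\in\mathbb Z$, $n_s\in\mathbb Z^+$) be a $(d^*(G)+p^h)$-cover of $\mathbb Z$. Let $c_1,\ldots,c_k\in G$ and $m_1,\ldots,m_k\in\mathbb Z$. Then for any $c\in G$ and any rational number $\alpha$, $$\Big|\Big\{I\subseteq\{1,\ldots,k\}:\ \sum_{s\in I}c_s=c\ \text{and}\ \sum_{s\in I}\frac{m_s}{n_s}\in\alpha+p^h\mathbb Z\Big\}\Big|\neq 1.$$ In particular, there is a nonempty $I\subseteq\{1,\ldots,k\}$ with $\sum_{s\in I}c_s=0$ and $\sum_{s\in I}m_s/n_s\in p^h\mathbb Z$.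
   Context: For $a\in\mathbb Z$ and $n\in\mathbb Z^+$, $a(n)=a+n\mathbb Z$ is a residue class. For a finite system $A=\{a_s(n_s)\}_{s=1}^k$, its covering function is $w_A(x)=|\{1\le s\le k: x\in a_s(n_s)\}|$; $A$ is an $m$-cover of $\mathbb Z$ if $w_A(x)\ge m$ for all $x\in\mathbb Z$. For a finite abelian group $G$ with $|G|>1$, write $G\cong\mathbb Z_{d_1}\oplus\cdots\oplus\mathbb Z_{d_r}$ with $1<d_1\mid d_2\mid\cdots\mid d_r$ (unique such decomposition) and set $d^*(G)=\sum_{i=1}^r(d_i-1)$; if $|G|=1$ set $d^*(G)=0$. *)

theory Defs
  imports "HOL-Algebra.Algebra"
begin

(* Abelian groups are HOL-Algebra comm_groups, which are written multiplicatively: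
   0 and the sum of the c s over s in I become \<one>\<^bsub>G\<^esub> and finprod G c I. *)

definition residue_class :: "int \<Rightarrow> int \<Rightarrow> int set" where
  "residue_class a n = {a + n * t |t. True}"

text \<open>A finite system of residue classes is given by its length \<open>k\<close> and the families
  \<open>a\<close>, \<open>n\<close>, of which only the values at \<open>1, \<dots>, k\<close> matter.\<close>

definition covering_function :: "nat \<Rightarrow> (nat \<Rightarrow> int) \<Rightarrow> (nat \<Rightarrow> int) \<Rightarrow> int \<Rightarrow> nat" where
  "covering_function k a n x = card {s \<in> {1..k}. x \<in> residue_class (a s) (n s)}"

definition is_m_cover :: "nat \<Rightarrow> nat \<Rightarrow> (nat \<Rightarrow> int) \<Rightarrow> (nat \<Rightarrow> int) \<Rightarrow> bool" where
  "is_m_cover m k a n \<longleftrightarrow> (\<forall>x. covering_function k a n x \<ge> m)"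

text \<open>The lists \<open>[d\<^sub>1, \<dots>, d\<^sub>r]\<close> with \<open>1 < d\<^sub>1\<close>, \<open>d\<^sub>1 | d\<^sub>2 | \<dots> | d\<^sub>r\<close> and \<open>G\<close> isomorphic to the
  direct sum of the cyclic groups of orders \<open>d\<^sub>1, \<dots>, d\<^sub>r\<close>.\<close>

definition invariant_factors :: "('a, 'b) monoid_scheme \<Rightarrow> nat list \<Rightarrow> bool" where
  "invariant_factors G ds \<longleftrightarrow>
     (\<forall>d \<in> set ds. 1 < d) \<and> successively (dvd) ds \<and>
     G \<cong> sum_group {..<length ds} (\<lambda>i. integer_mod_group (ds ! i))"

text \<open>For a finite abelian group the list of invariant factors exists and is unique, so the
  choice below is no choice.\<close>

definition d_star :: "('a, 'b) monoid_scheme \<Rightarrow> nat" where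
  "d_star G =
     (if order G = 1 then 0
      else (\<Sum>d \<leftarrow> (SOME ds. invariant_factors G ds). d - 1))"

definition finite_abelian_p_group :: "nat \<Rightarrow> ('a, 'b) monoid_scheme \<Rightarrow> bool" where
  "finite_abelian_p_group p G \<longleftrightarrow>
     comm_group G \<and> finite (carrier G) \<and> (\<exists>e. order G = p ^ e)"

end

theory Submission
  imports Defs "Jordan_Normal_Form.Char_Poly"
begin

text \<open>
  Suppose that \<open>I\<^sub>0\<close> is the only index set with its two sums. Membership of \<open>I\<close> in the solution set is
  a condition of divisibility by \<open>p\<close>-powers, one for each invariant factor and one for \<open>p\<^sup>h\<close>, and
  \<open>y\<close> is divisible by \<open>q = p\<^sup>e\<close> iff the binomial coefficient of \<open>y - 1\<close> over \<open>q - 1\<close> is not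
  divisible by \<open>p\<close>. The product of these binomial coefficients is a polynomial \<open>F(I)\<close> in the
  indicators of \<open>I\<close> of degree \<open>d\<^sup>*(G) + p\<^sup>h - 1\<close>. Writing \<open>\<theta>\<^sub>I\<close> for the sum of the \<open>m\<^sub>s/n\<^sub>s\<close> over
  \<open>I\<close>, the covering hypothesis gives, for every integer \<open>x\<close>, that the sum over all \<open>I\<close> of
  \<open>(-1)\<^bsup>|I|\<^esup> F(I) \<Prod>\<^bsub>s\<in>I\<^esub> exp(2\<pi>i (x - a\<^sub>s) m\<^sub>s/n\<^sub>s)\<close> vanishes, as more factors of
  \<open>\<Prod>(1 - exp(2\<pi>i (x - a\<^sub>s) m\<^sub>s/n\<^sub>s))\<close> vanish than the degree of \<open>F\<close>. Averaging over \<open>x\<close>, the sum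
  restricted to those \<open>I\<close> with \<open>\<theta>\<^sub>I \<equiv> \<theta>\<close> modulo 1, where \<open>\<theta>\<close> belongs to \<open>I\<^sub>0\<close>, vanishes too. There
  \<open>F\<close> is integer valued, and divisible by \<open>p\<close> except at \<open>I\<^sub>0\<close>; so \<open>F(I\<^sub>0)/p\<close> is an algebraic
  integer, hence an integer, a contradiction.
\<close>

subsection \<open>Signed sums over subsets\<close>

lemma sum_Pow_containing:
  assumes "s \<in> S"
  shows "(\<Sum>I\<in>{I\<in>Pow S. s \<in> I}. f I) = (\<Sum>I\<in>Pow (S - {s}). f (insert s I))"
  by (rule sum.reindex_bij_witness[of _ "insert s" "\<lambda>I. I - {s}"])
    (use assms in \<open>auto simp: insert_absorb\<close>)

text \<open>If no linear form is left, the sum is \<open>\<Prod>(1 - z\<^sub>s)\<close>; expanding one linear form removes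
  one index \<open>s\<close> from \<open>S\<close>, hence at most one of the vanishing factors.\<close>

lemma signed_subset_sum_linear_forms_eq_0:
  fixes z :: "'s \<Rightarrow> 'a :: comm_ring_1" and v :: "'j \<Rightarrow> 'a"
  assumes "finite J" "finite S" "card J < card {s\<in>S. z s = 1}"
  shows "(\<Sum>I\<in>Pow S. (-1) ^ card I * (\<Prod>j\<in>J. v j + sum (u j) I) * prod z I) = 0"
  using assms
proof (induction J arbitrary: S v rule: finite_induct)
  case empty
  then obtain s where s: "s \<in> S" "z s = 1"
    by (metis (mono_tags, lifting) Collect_empty_eq card.empty not_less_zero)
  have "(\<Sum>I\<in>Pow S. (-1) ^ card I * prod z I) = (\<Sum>I\<in>Pow S. (\<Prod>s\<in>I. - z s) * (\<Prod>s\<in>S - I. 1))"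
    by (intro sum.cong) (auto simp: prod_uminus)
  also have "\<dots> = (\<Prod>s\<in>S. - z s + 1)"
    by (rule prod_add[OF empty(1), symmetric])
  also have "\<dots> = 0"
    using s empty by (intro prod_zero) auto
  finally show ?case by simp
next
  case (insert j J)
  define g where "g I = (-1) ^ card I * (\<Prod>j\<in>J. v j + sum (u j) I) * prod z I" for I
  have g0: "(\<Sum>I\<in>Pow S. g I) = 0"
    unfolding g_def using insert by (intro insert.IH) auto
  \<comment> \<open>Removing \<open>s\<close> from \<open>I\<close> shifts the constants from
    \<open>v j\<close> to \<open>v j + u j s\<close>; hence the induction over arbitrary
    \<open>v\<close> and \<open>S\<close>.\<close>
  have gs: "(\<Sum>I\<in>{I\<in>Pow S. s \<in> I}. g I) = 0" if s: "s \<in> S" for s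
  proof -
    have "card {t\<in>S. z t = 1} \<le> card (insert s {t\<in>S - {s}. z t = 1})"
      using insert.prems(1) by (intro card_mono) auto
    also have "\<dots> \<le> Suc (card {t\<in>S - {s}. z t = 1})"
      using insert.prems(1) by (simp add: card_insert_if)
    finally have "card J < card {t\<in>S - {s}. z t = 1}"
      using insert.prems insert.hyps by simp
    then have *: "(\<Sum>I\<in>Pow (S - {s}). (-1) ^ card I * (\<Prod>j\<in>J. (v j + u j s) + sum (u j) I) * prod z I) = 0"
      using insert.prems by (intro insert.IH) auto
    have "g (insert s I) = - z s * ((-1) ^ card I * (\<Prod>j\<in>J. (v j + u j s) + sum (u j) I) * prod z I)"
      if "I \<in> Pow (S - {s})" for I
    proof -
      have "finite I" "s \<notin> I"
        using that insert.prems(1) by (auto intro: finite_subset)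
      then show ?thesis
        by (simp add: g_def algebra_simps)
    qed
    then have "(\<Sum>I\<in>Pow (S - {s}). g (insert s I)) = - z s *
        (\<Sum>I\<in>Pow (S - {s}). (-1) ^ card I * (\<Prod>j\<in>J. (v j + u j s) + sum (u j) I) * prod z I)"
      unfolding sum_distrib_left by (rule sum.cong[OF refl])
    then have "(\<Sum>I\<in>Pow (S - {s}). g (insert s I)) = 0"
      using * by simp
    then show ?thesis
      by (simp only: sum_Pow_containing[OF s])
  qed
  have "(\<Sum>I\<in>Pow S. sum (u j) I * g I) = (\<Sum>I\<in>Pow S. \<Sum>s\<in>S. if s \<in> I then u j s * g I else 0)"
  proof (rule sum.cong)
    fix I assume "I \<in> Pow S"
    then have "S \<inter> I = I" by auto
    then have "sum (u j) I = (\<Sum>s\<in>S. if s \<in> I then u j s else 0)"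
      using sum.inter_restrict[OF insert.prems(1), of "u j" I] by simp
    then show "sum (u j) I * g I = (\<Sum>s\<in>S. if s \<in> I then u j s * g I else 0)"
      by (auto simp: sum_distrib_right intro!: sum.cong)
  qed simp
  also have "\<dots> = (\<Sum>s\<in>S. \<Sum>I\<in>Pow S. if s \<in> I then u j s * g I else 0)"
    by (rule sum.swap)
  also have "\<dots> = (\<Sum>s\<in>S. u j s * (\<Sum>I\<in>{I\<in>Pow S. s \<in> I}. g I))"
    using insert.prems(1) by (simp add: sum.inter_filter[symmetric] sum_distrib_left)
  also have "\<dots> = 0"
    by (intro sum.neutral ballI) (simp only: gs mult_zero_right)
  finally have "(\<Sum>I\<in>Pow S. v j * g I + sum (u j) I * g I) = 0"
    using g0 by (simp add: sum.distrib flip: sum_distrib_left)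
  then show ?case
    using insert.hyps by (simp add: g_def algebra_simps)
qed

subsection \<open>Binomial coefficients modulo a prime\<close>

text \<open>In \<open>k * (p ^ e choose k) = p ^ e * (p ^ e - 1 choose (k - 1))\<close>, a
  coefficient \<open>p ^ e choose k\<close> prime to \<open>p\<close> would force
  \<open>p ^ e\<close> to divide \<open>k\<close>.\<close>

lemma prime_dvd_prime_power_choose:
  fixes p :: nat
  assumes "Factorial_Ring.prime p" "0 < k" "k < p ^ e"
  shows "p dvd (p ^ e choose k)"
proof (rule ccontr)
  assume "\<not> p dvd (p ^ e choose k)"
  then have "Rings.coprime (p ^ e) (p ^ e choose k)"
    using assms(1) by (simp add: prime_imp_coprime)
  moreover have "p ^ e dvd k * (p ^ e choose k)"
    using assms by (metis Suc_pred dvd_triv_left less_imp_Suc_add times_binomial_minus1_eq)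
  ultimately have "p ^ e dvd k"
    by (simp add: coprime_dvd_mult_left_iff)
  then show False
    using assms by (simp add: nat_dvd_not_less)
qed

text \<open>Modulo \<open>p\<close> the value has period \<open>q = p ^ e\<close> in
  \<open>y\<close>, by Vandermonde's identity, and among \<open>0, ..., q - 1\<close> only
  \<open>y = q - 1\<close> gives a nonzero value.\<close>

lemma prime_dvd_choose_iff_not_dvd:
  fixes p :: nat
  assumes p: "Factorial_Ring.prime p"
  shows "p dvd (y choose (p ^ e - 1)) \<longleftrightarrow> \<not> p ^ e dvd Suc y"
proof (induction y rule: less_induct)
  case (less y)
  have q0: "p ^ e > 0" 
    using p by (simp add: prime_gt_0_nat)
  consider "Suc y < p ^ e" | "Suc y = p ^ e" | "y \<ge> p ^ e" by linarith
  then show ?case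
  proof cases
    case 1
    then show ?thesis by (simp add: binomial_eq_0 nat_dvd_not_less)
  next
    case 2
    moreover have "p ^ e - 1 = y"
      using 2 by simp
    ultimately show ?thesis
      using p not_prime_1 by auto
  next
    case 3
    define q where "q = p ^ e"
    define x where "x = y - q"
    have y: "y = q + x" and "x < y"
      using 3 q0 unfolding q_def x_def by linarith+
    \<comment> \<open>The lower index \<open>q - 1\<close> keeps the term \<open>k = q\<close> out
      of the sum; every \<open>k\<close> from 1 to \<open>q - 1\<close> gives a multiple of
      \<open>p\<close>.\<close>
    have "(y choose (q - 1)) = (\<Sum>k\<le>q-1. (q choose k) * (x choose (q - 1 - k)))"
      by (simp only: y vandermonde)
    also have "\<dots> = (x choose (q - 1)) + (\<Sum>k\<in>{1..q-1}. (q choose k) * (x choose (q - 1 - k)))"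
      by (simp add: atMost_atLeast0 sum.atLeast_Suc_atMost)
    finally have "p dvd (y choose (q - 1)) \<longleftrightarrow> p dvd (x choose (q - 1))"
    proof -
      assume eq: "(y choose (q - 1)) = (x choose (q - 1)) + (\<Sum>k\<in>{1..q-1}. (q choose k) * (x choose (q - 1 - k)))"
      have "p dvd (\<Sum>k\<in>{1..q-1}. (q choose k) * (x choose (q - 1 - k)))"
        unfolding q_def using p by (intro dvd_sum dvd_mult2 prime_dvd_prime_power_choose) auto
      then show ?thesis
        unfolding eq by (rule dvd_add_left_iff)
    qed
    moreover have "q dvd Suc y \<longleftrightarrow> q dvd Suc x"
      unfolding y by (metis add_Suc_right dvd_add_triv_left_iff)
    ultimately show ?thesis
      using less[OF \<open>x < y\<close>] by (simp add: q_def)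
  qed
qed

text \<open>\<open>gchoose\<close> makes the indicator a polynomial in \<open>y\<close>. For
  positive \<open>y\<close> it is an ordinary binomial coefficient; with \<open>q = p ^ e\<close>,
  the reflection \<open>y \<mapsto> q - y\<close> changes it only by the sign
  \<open>(-1) ^ (q - 1)\<close> and respects divisibility by \<open>q\<close>, which settles
  \<open>y \<le> 0\<close>.\<close>

lemma gbinomial_indicator_prime_power:
  fixes y :: int
  assumes p: "Factorial_Ring.prime p"
  obtains v :: int where "((of_int y - 1) gchoose (p ^ e - 1) :: 'a :: field_char_0) = of_int v"
    and "int p dvd v \<longleftrightarrow> \<not> int (p ^ e) dvd y"
proof -
  define q where "q = p ^ e"
  have q0: "q > 0"
    using p by (simp add: q_def prime_gt_0_nat)
  have pos: "((of_int y - 1) gchoose (q - 1) :: 'a) = of_int (int (nat (y - 1) choose (q - 1)))"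
    "int p dvd int (nat (y - 1) choose (q - 1)) \<longleftrightarrow> \<not> int q dvd y" if "y > 0" for y
  proof -
    define x where "x = nat (y - 1)"
    have y: "y = int (Suc x)"
      using that by (simp add: x_def)
    then show "((of_int y - 1) gchoose (q - 1) :: 'a) = of_int (int (nat (y - 1) choose (q - 1)))"
      by (simp add: binomial_gbinomial)
    show "int p dvd int (nat (y - 1) choose (q - 1)) \<longleftrightarrow> \<not> int q dvd y"
      using prime_dvd_choose_iff_not_dvd[OF p, of x e]
      by (simp only: y int_dvd_int_iff q_def) simp
  qed
  show thesis
  proof (cases "y > 0")
    case True
    show ?thesis
      by (rule that[folded q_def, OF pos[OF True]])
  next
    case False
    then have y: "int q - y > 0"
      using q0 by linarith
    define v where "v = int (nat (int q - y - 1) choose (q - 1))"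
    have "((of_int y - 1) gchoose (q - 1) :: 'a) = (-1) ^ (q - 1) * ((of_int (int q - y) - 1) gchoose (q - 1))"
      by (subst gbinomial_negated_upper) (use q0 in \<open>simp add: of_nat_diff algebra_simps\<close>)
    also have "\<dots> = of_int ((-1) ^ (q - 1) * v)"
      by (simp only: pos(1)[OF y] v_def) simp
    finally have "((of_int y - 1) gchoose (q - 1) :: 'a) = of_int ((-1) ^ (q - 1) * v)" .
    moreover have "int p dvd (-1) ^ (q - 1) * v \<longleftrightarrow> int p dvd v"
      by (auto simp: minus_one_power_iff)
    moreover have "int p dvd v \<longleftrightarrow> \<not> int q dvd y"
      unfolding v_def pos(2)[OF y] by (simp add: dvd_diff_right_iff)
    ultimately show ?thesis
      by (intro that[folded q_def, of "(-1) ^ (q - 1) * v"]) blast+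
  qed
qed

text \<open>As \<open>p\<close> is prime, the product is nonzero modulo \<open>p\<close> exactly
  when all factors are, so it tests all divisibilities at once. The \<open>y i\<close> are field
  elements because one of them will be a difference of sums of fractions.\<close>

lemma gbinomial_prod_indicator:
  fixes y :: "'i \<Rightarrow> 'a :: field_char_0"
  assumes p: "Factorial_Ring.prime p" and T: "finite T" and y: "\<And>i. i \<in> T \<Longrightarrow> y i \<in> \<int>"
  obtains V :: int where "(\<Prod>i\<in>T. (y i - 1) gchoose (p ^ e i - 1)) = of_int V"
    and "int p dvd V \<longleftrightarrow> (\<exists>i\<in>T. y i / of_nat (p ^ e i) \<notin> \<int>)"
proof -
  have "\<exists>v::int. (y i - 1) gchoose (p ^ e i - 1) = of_int v \<and> (int p dvd v \<longleftrightarrow> y i / of_nat (p ^ e i) \<notin> \<int>)"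
    if i: "i \<in> T" for i
  proof -
    obtain z where z: "y i = of_int z"
      using y[OF i] by (auto elim: Ints_cases)
    obtain v :: int where v: "((of_int z - 1) gchoose (p ^ e i - 1) :: 'a) = of_int v"
      "int p dvd v \<longleftrightarrow> \<not> int (p ^ e i) dvd z"
      by (rule gbinomial_indicator_prime_power[OF p])
    have q0: "int (p ^ e i) \<noteq> 0"
      using p by (simp add: prime_gt_0_nat)
    have "y i / of_nat (p ^ e i) \<in> \<int> \<longleftrightarrow> of_int z / of_int (int (p ^ e i)) \<in> (\<int> :: 'a set)"
      by (simp only: z of_int_of_nat_eq)
    also have "\<dots> \<longleftrightarrow> int (p ^ e i) dvd z"
      unfolding of_int_div_of_int_in_Ints_iff using q0 by blast
    finally show ?thesis
      using v z by auto
  qed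
  then obtain v where v: "\<And>i. i \<in> T \<Longrightarrow> (y i - 1) gchoose (p ^ e i - 1) = of_int (v i)"
    "\<And>i. i \<in> T \<Longrightarrow> int p dvd v i \<longleftrightarrow> y i / of_nat (p ^ e i) \<notin> \<int>"
    by metis
  show thesis
  proof (rule that[of "prod v T"])
    show "(\<Prod>i\<in>T. (y i - 1) gchoose (p ^ e i - 1)) = of_int (prod v T)"
      using v(1) by (simp only: of_int_prod) (rule prod.cong[OF refl])
    show "int p dvd prod v T \<longleftrightarrow> (\<exists>i\<in>T. y i / of_nat (p ^ e i) \<notin> \<int>)"
      using p T v(2) by (subst prime_dvd_prod_iff) auto
  qed
qed

subsection \<open>Roots of unity\<close>

lemma algebraic_int_sum_roots_of_unity:
  fixes \<zeta> :: complex
  assumes S: "finite S" and N: "N > 0" and \<zeta>: "\<zeta> ^ N = 1"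
  shows "algebraic_int (\<Sum>x\<in>S. of_int (b x) * \<zeta> ^ (e x))"
proof -
  \<comment> \<open>The sum is an eigenvalue, with eigenvector \<open>(1, \<zeta>, \<dots>, \<zeta>\<^sup>N\<^sup>-\<^sup>1)\<close>, of an integer matrix.\<close>
  define y where "y = (\<Sum>x\<in>S. of_int (b x) * \<zeta> ^ (e x))"
  define B :: "int mat" where "B = mat N N (\<lambda>(i, j). \<Sum>x\<in>{x\<in>S. (i + e x) mod N = j}. b x)"
  define w where "w = vec N (\<lambda>i. \<zeta> ^ i)"
  let ?A = "map_mat complex_of_int B"
  have A: "?A \<in> carrier_mat N N" and B: "B \<in> carrier_mat N N"
    by (simp_all add: B_def)
  have mod: "\<zeta> ^ (t mod N) = \<zeta> ^ t" for t
    by (metis \<zeta> mod_mult_div_eq power_add power_mult power_one mult.right_neutral)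
  have "?A *\<^sub>v w = y \<cdot>\<^sub>v w"
  proof (rule eq_vecI)
    fix i assume "i < dim_vec (y \<cdot>\<^sub>v w)"
    then have i: "i < N" by (simp add: w_def)
    \<comment> \<open>Row \<open>i\<close> of \<open>B\<close> holds the coefficients of
      \<open>\<zeta> ^ i * y\<close> with exponents reduced modulo \<open>N\<close>; the sum over
      \<open>j\<close> merely regroups the terms.\<close>
    have "(?A *\<^sub>v w) $ i = (\<Sum>j<N. of_int (\<Sum>x\<in>{x\<in>S. (i + e x) mod N = j}. b x) * \<zeta> ^ j)"
      using i by (simp add: w_def B_def scalar_prod_def atLeast0LessThan)
    also have "\<dots> = (\<Sum>j<N. \<Sum>x\<in>{x\<in>S. (i + e x) mod N = j}. of_int (b x) * \<zeta> ^ (i + e x))"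
      by (intro sum.cong) (auto simp: sum_distrib_right mod intro!: sum.cong)
    also have "\<dots> = (\<Sum>x\<in>S. of_int (b x) * \<zeta> ^ (i + e x))"
      using S N by (intro sum.group) auto
    also have "\<dots> = (y \<cdot>\<^sub>v w) $ i"
      using i by (simp add: y_def w_def sum_distrib_left power_add mult_ac)
    finally show "(?A *\<^sub>v w) $ i = (y \<cdot>\<^sub>v w) $ i" .
  qed (simp_all add: w_def B_def)
  moreover have "w $ 0 \<noteq> 0\<^sub>v N $ 0"
    using N by (simp add: w_def)
  then have "w \<noteq> 0\<^sub>v N" by auto
  ultimately have "eigenvector ?A w y"
    by (simp add: eigenvector_def w_def B_def)
  then have "poly (map_poly of_int (char_poly B)) y = 0"
    using eigenvalue_root_char_poly[OF A] of_int_hom.char_poly_hom[OF B]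
    by (metis eigenvalue_def)
  moreover have "lead_coeff (char_poly B) = 1"
    using degree_monic_char_poly[OF B] by simp
  ultimately have "algebraic_int y"
    unfolding algebraic_int_altdef_ipoly by blast
  then show ?thesis
    by (simp only: y_def)
qed

lemma cis_eq_1_imp_dvd:
  fixes N d :: int
  assumes "N > 0" "cis (2 * pi * of_int d / of_int N) = 1"
  shows "N dvd d"
proof -
  have "cos (2 * pi * of_int d / of_int N) = 1"
    using assms(2) by (metis cis.sel(1) one_complex.sel(1))
  then obtain k :: int where k: "2 * pi * of_int d / of_int N = of_int k * 2 * pi"
    by (auto simp: cos_one_2pi_int)
  have "real_of_int d = of_int (k * N)"
    using k assms(1) by (simp add: field_simps)
  then show ?thesis
    by (simp only: of_int_eq_iff) simp
qed

subsection \<open>Subset sums for covers\<close>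

text \<open>Group conditions and fraction condition enter alike, as linear forms \<open>U i\<close>
  tested modulo \<open>p ^ e i\<close>. All sums are taken relative to \<open>I\<^sub>0\<close>, so
  that \<open>I\<^sub>0\<close> itself passes every test. Integrality of the forms is demanded only
  where \<open>\<delta>\<close> is an integer, since the fraction form is integral only
  there.\<close>

lemma subset_sum_not_unique:
  fixes S :: "'s set" and a n m :: "'s \<Rightarrow> int" and U :: "'i \<Rightarrow> 's \<Rightarrow> complex" and e :: "'i \<Rightarrow> nat"
  defines "\<delta> \<equiv> (\<lambda>I J. (\<Sum>s\<in>I. of_int (m s) / of_int (n s)) - (\<Sum>s\<in>J. of_int (m s) / of_int (n s)) :: complex)"
  assumes p: "Factorial_Ring.prime p" and S: "finite S" and T: "finite T"
    and n: "\<And>s. s \<in> S \<Longrightarrow> n s > 0"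
    and cover: "\<And>x. (\<Sum>i\<in>T. p ^ e i - 1) < card {s\<in>S. n s dvd x - a s}"
    and I0: "I\<^sub>0 \<subseteq> S"
    and ints: "\<And>I i. \<lbrakk>I \<subseteq> S; \<delta> I I\<^sub>0 \<in> \<int>; i \<in> T\<rbrakk> \<Longrightarrow> sum (U i) I - sum (U i) I\<^sub>0 \<in> \<int>"
  obtains I where "I \<subseteq> S" "I \<noteq> I\<^sub>0" "\<delta> I I\<^sub>0 \<in> \<int>"
    "\<And>i. i \<in> T \<Longrightarrow> (sum (U i) I - sum (U i) I\<^sub>0) / of_nat (p ^ e i) \<in> \<int>"
proof (rule ccontr)
  note found = that
  assume not_thesis: "\<not> thesis"
  \<comment> \<open>A common denominator: with \<open>M s / N = m s / n s\<close> below, every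
    exponential that occurs is a power of the root of unity \<open>w 1\<close>.\<close>
  define N where "N = (\<Prod>s\<in>S. n s)"
  have N: "N > 0"
    unfolding N_def using n by (simp add: prod_pos)
  have n_dvd: "n s dvd N" if "s \<in> S" for s
    unfolding N_def using S that by (rule dvd_prodI)
  define w where "w t = cis (2 * pi * of_int t / of_int N)" for t :: int
  have w_add: "w (s + t) = w s * w t" for s t
    by (simp add: w_def cis_mult ring_distribs add_divide_distrib)
  have w_1: "w t = 1" if t: "N dvd t" for t
  proof -
    obtain k where k: "t = N * k" using t by auto
    have "2 * pi * of_int t / of_int N = 2 * pi * of_int k"
      using N by (simp add: k)
    then show ?thesis
      by (simp add: w_def)
  qed
  have w_0: "w 0 = 1"
    by (rule w_1) simp
  have w_dvd: "N dvd t" if "w t = 1" for t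
    using cis_eq_1_imp_dvd N that unfolding w_def by blast
  have w_pow: "w t ^ k = w (int k * t)" for t k
    by (induction k) (simp_all add: w_0 w_add[symmetric] algebra_simps)
  have w_sum: "w (sum f I) = (\<Prod>s\<in>I. w (f s))" for f and I :: "'s set"
    by (induction I rule: infinite_finite_induct) (simp_all add: w_0 w_add)
  have w_power: "w t = w 1 ^ nat (t mod N)" for t
  proof -
    have "w t = w (N * (t div N)) * w (t mod N)"
      by (simp flip: w_add)
    then show ?thesis
      using N by (simp add: w_1 w_pow)
  qed

  define M where "M s = m s * (N div n s)" for s
  have M: "complex_of_int (m s) / of_int (n s) = of_int (M s) / of_int N" if s: "s \<in> S" for s
  proof -
    obtain k where k: "N = n s * k"
      using n_dvd[OF s] by auto
    then show ?thesis
      using N n[OF s] by (auto simp: M_def)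
  qed
  define \<mu> where "\<mu> I = sum M I" for I
  have \<delta>: "\<delta> I I\<^sub>0 = of_int (\<mu> I - \<mu> I\<^sub>0) / of_int N" if "I \<subseteq> S" for I
  proof -
    have "(\<Sum>s\<in>I. of_int (m s) / of_int (n s) :: complex) = of_int (\<mu> I) / of_int N" if "I \<subseteq> S" for I
      using that M by (simp add: \<mu>_def sum_divide_distrib subset_iff)
    then show ?thesis
      using that I0 by (simp add: \<delta>_def diff_divide_distrib)
  qed

  define E where "E I = (\<Sum>s\<in>I. a s * M s)" for I
  \<comment> \<open>The binomial coefficients times their factorials split into linear factors
    \<open>y - 1 - l\<close> with \<open>l < p ^ e i - 1\<close>; the pairs \<open>(i, l)\<close>
    form \<open>J\<close>, so \<open>F\<close> is a product of \<open>card J\<close> linear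
    forms.\<close>
  define J where "J = (SIGMA i:T. {..<p ^ e i - 1})"
  define F where "F I = (\<Prod>j\<in>J. (- sum (U (fst j)) I\<^sub>0 - 1 - of_nat (snd j)) + sum (U (fst j)) I)" for I
  define C :: complex where "C = (\<Prod>i\<in>T. fact (p ^ e i - 1))"
  have F: "F I = C * (\<Prod>i\<in>T. (sum (U i) I - sum (U i) I\<^sub>0 - 1) gchoose (p ^ e i - 1))" for I
  proof -
    have "F I = (\<Prod>i\<in>T. \<Prod>l<p ^ e i - 1. (sum (U i) I - sum (U i) I\<^sub>0 - 1) - of_nat l)"
      unfolding F_def J_def using T by (subst prod.Sigma) (auto simp: algebra_simps split_def)
    also have "\<dots> = (\<Prod>i\<in>T. fact (p ^ e i - 1) * ((sum (U i) I - sum (U i) I\<^sub>0 - 1) gchoose (p ^ e i - 1)))"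
      by (simp add: gbinomial_mult_fact atLeast0LessThan)
    finally show ?thesis
      by (simp add: C_def prod.distrib)
  qed
  have C: "C \<noteq> 0"
    using T by (simp add: C_def)

  have vanish: "(\<Sum>I\<in>Pow S. (-1) ^ card I * F I * (w (x * \<mu> I) * w (- E I))) = 0" for x
  proof -
    have "card J = (\<Sum>i\<in>T. p ^ e i - 1)"
      using T by (simp add: J_def)
    also have "\<dots> < card {s\<in>S. n s dvd x - a s}"
      by (rule cover)
    \<comment> \<open>Each class containing \<open>x\<close> gives a vanishing factor
      \<open>1 - w ((x - a s) * M s)\<close>, because \<open>N\<close> divides
      \<open>(x - a s) * M s\<close>.\<close>
    also have "\<dots> \<le> card {s\<in>S. w ((x - a s) * M s) = 1}"
    proof (rule card_mono)
      show "{s\<in>S. n s dvd x - a s} \<subseteq> {s\<in>S. w ((x - a s) * M s) = 1}"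
      proof safe
        fix s assume s: "s \<in> S" "n s dvd x - a s"
        have "n s * (N div n s) dvd (x - a s) * M s"
          unfolding M_def using s(2) by (intro mult_dvd_mono) auto
        then show "w ((x - a s) * M s) = 1"
          using n_dvd[OF s(1)] by (intro w_1) simp
      qed
    qed (use S in simp)
    finally have "(\<Sum>I\<in>Pow S. (-1) ^ card I * F I * (\<Prod>s\<in>I. w ((x - a s) * M s))) = 0"
      unfolding F_def using S T
      by (intro signed_subset_sum_linear_forms_eq_0) (auto simp: J_def)
    moreover have "(\<Prod>s\<in>I. w ((x - a s) * M s)) = w (x * \<mu> I) * w (- E I)" for I
      unfolding w_add[symmetric] w_sum[symmetric]
      by (simp add: E_def \<mu>_def sum_distrib_left sum_subtractf algebra_simps)
    ultimately show ?thesis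
      by simp
  qed

  \<comment> \<open>Averaging over \<open>x\<close> keeps only those \<open>I\<close> whose sum agrees with that of \<open>I\<^sub>0\<close> modulo 1.\<close>
  have geometric: "(\<Sum>x<nat N. w (int x * d)) = (if w d = 1 then of_int N else 0)" for d
  proof (cases "w d = 1")
    case True
    then show ?thesis
      using N by (simp flip: w_pow)
  next
    case False
    have "(\<Sum>x<nat N. w (int x * d)) = (w d ^ nat N - 1) / (w d - 1)"
      using False by (simp add: geometric_sum flip: w_pow)
    also have "w d ^ nat N = 1"
      using N by (simp add: w_pow w_1)
    finally show ?thesis
      using False by simp
  qed
  define D where "D = {I\<in>Pow S. w (\<mu> I - \<mu> I\<^sub>0) = 1}"
  \<comment> \<open>The inner geometric sum is \<open>N\<close> times the indicator of
    \<open>D\<close>; after the exchange of sums each \<open>x\<close> contributes a multiple of the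
    sum in \<open>vanish\<close>.\<close>
  have "(\<Sum>I\<in>D. (-1) ^ card I * F I * w (- E I)) * of_int N =
    (\<Sum>I\<in>Pow S. (-1) ^ card I * F I * w (- E I) * (\<Sum>x<nat N. w (int x * (\<mu> I - \<mu> I\<^sub>0))))"
    using S unfolding geometric D_def
    by (subst sum.inter_filter) (auto simp: sum_distrib_right intro!: sum.cong)
  also have "\<dots> = (\<Sum>I\<in>Pow S. \<Sum>x<nat N. w (- int x * \<mu> I\<^sub>0) *
      ((-1) ^ card I * F I * (w (int x * \<mu> I) * w (- E I))))"
    unfolding sum_distrib_left
  proof (intro sum.cong refl)
    fix I x
    have "w (int x * (\<mu> I - \<mu> I\<^sub>0)) = w (- int x * \<mu> I\<^sub>0) * w (int x * \<mu> I)"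
      by (simp only: w_add[symmetric]) (simp add: right_diff_distrib)
    then show "(-1) ^ card I * F I * w (- E I) * w (int x * (\<mu> I - \<mu> I\<^sub>0)) =
        w (- int x * \<mu> I\<^sub>0) * ((-1) ^ card I * F I * (w (int x * \<mu> I) * w (- E I)))"
      by (simp only: mult_ac)
  qed
  also have "\<dots> = (\<Sum>x<nat N. w (- int x * \<mu> I\<^sub>0) *
      (\<Sum>I\<in>Pow S. (-1) ^ card I * F I * (w (int x * \<mu> I) * w (- E I))))"
    unfolding sum_distrib_left by (rule sum.swap)
  also have "\<dots> = 0"
    by (simp only: vanish mult_zero_right sum.neutral_const)
  finally have D_sum: "(\<Sum>I\<in>D. (-1) ^ card I * F I * w (- E I)) = 0"
    using N by simp

  have finD: "finite D" and I0D: "I\<^sub>0 \<in> D"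
    using S I0 by (simp_all add: D_def w_0)
  have \<delta>D: "\<delta> I I\<^sub>0 \<in> \<int>" if "I \<in> D" for I
  proof -
    have "I \<subseteq> S" and "N dvd \<mu> I - \<mu> I\<^sub>0"
      using that by (auto simp: D_def intro: w_dvd)
    then show ?thesis
      unfolding \<delta>[OF \<open>I \<subseteq> S\<close>] of_int_div_of_int_in_Ints_iff by simp
  qed
  \<comment> \<open>On \<open>D\<close> the forms are integral, so \<open>F\<close> is there the
    nonzero constant \<open>C\<close> times an integer, and \<open>C\<close> can be
    cancelled.\<close>
  have "\<exists>V::int. F I = C * of_int V \<and>
      (int p dvd V \<longleftrightarrow> (\<exists>i\<in>T. (sum (U i) I - sum (U i) I\<^sub>0) / of_nat (p ^ e i) \<notin> \<int>))" if "I \<in> D" for I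
  proof -
    have y: "sum (U i) I - sum (U i) I\<^sub>0 \<in> \<int>" if "i \<in> T" for i
      using \<delta>D[OF \<open>I \<in> D\<close>] \<open>I \<in> D\<close> that by (intro ints) (auto simp: D_def)
    obtain V :: int where
      "(\<Prod>i\<in>T. (sum (U i) I - sum (U i) I\<^sub>0 - 1) gchoose (p ^ e i - 1)) = of_int V"
      "int p dvd V \<longleftrightarrow> (\<exists>i\<in>T. (sum (U i) I - sum (U i) I\<^sub>0) / of_nat (p ^ e i) \<notin> \<int>)"
      by (rule gbinomial_prod_indicator[OF p T, of "\<lambda>i. sum (U i) I - sum (U i) I\<^sub>0" e, OF y])
    then show ?thesis
      unfolding F by (intro exI[of _ V]) simp
  qed
  then obtain V :: "'s set \<Rightarrow> int" where V: "\<And>I. I \<in> D \<Longrightarrow> F I = C * of_int (V I)"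
    "\<And>I. I \<in> D \<Longrightarrow> int p dvd V I \<longleftrightarrow> (\<exists>i\<in>T. (sum (U i) I - sum (U i) I\<^sub>0) / of_nat (p ^ e i) \<notin> \<int>)"
    by metis
  \<comment> \<open>At \<open>I\<^sub>0\<close> all differences are 0, so no divisibility
    fails.\<close>
  have V0: "\<not> int p dvd V I\<^sub>0"
    using V(2)[OF I0D] by simp
  \<comment> \<open>Any other \<open>I\<close> in \<open>D\<close> passing all tests would be the
    index set whose existence is being denied.\<close>
  have "int p dvd V I" if "I \<in> D - {I\<^sub>0}" for I
    using not_thesis found[of I] V(2)[of I] \<delta>D[of I] that by (auto simp: D_def)
  then obtain b where b: "\<And>I. I \<in> D - {I\<^sub>0} \<Longrightarrow> V I = int p * b I"
    unfolding dvd_def by metis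

  have p0: "of_nat p \<noteq> (0 :: complex)"
    using p by (simp add: prime_gt_0_nat)
  \<comment> \<open>\<open>R\<close> is \<open>V I\<^sub>0 / p\<close>, found by solving the
    vanishing sum over \<open>D\<close> for the term of \<open>I\<^sub>0\<close>. Reducing the
    exponents modulo \<open>N\<close> makes it an integer combination of natural powers of
    \<open>w 1\<close>.\<close>
  define R where "R = (\<Sum>I\<in>D - {I\<^sub>0}. of_int (- ((-1) ^ card I\<^sub>0 * (-1) ^ card I * b I)) * w 1 ^ nat ((E I\<^sub>0 - E I) mod N))"
  have "algebraic_int R"
    unfolding R_def using finD N
    by (intro algebraic_int_sum_roots_of_unity[of _ "nat N"]) (simp_all add: w_pow w_1)
  moreover have "of_int (V I\<^sub>0) = of_nat p * R"
  proof -
    have "0 = C * (\<Sum>I\<in>D. (-1) ^ card I * of_int (V I) * w (- E I))"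
      using D_sum by (simp add: V(1) sum_distrib_left mult_ac)
    then have "0 = (\<Sum>I\<in>D. (-1) ^ card I * of_int (V I) * w (- E I))"
      using C by simp
    also have "\<dots> = (-1) ^ card I\<^sub>0 * of_int (V I\<^sub>0) * w (- E I\<^sub>0) +
        (\<Sum>I\<in>D - {I\<^sub>0}. (-1) ^ card I * of_int (int p * b I) * w (- E I))"
      using finD I0D b by (subst sum.remove[of D "I\<^sub>0"]) auto
    finally have eq: "(-1) ^ card I\<^sub>0 * of_int (V I\<^sub>0) * w (- E I\<^sub>0) =
        - (\<Sum>I\<in>D - {I\<^sub>0}. (-1) ^ card I * of_int (int p * b I) * w (- E I))"
      by (simp add: eq_neg_iff_add_eq_0)
    have "of_int (V I\<^sub>0) = ((-1) ^ card I\<^sub>0 * w (E I\<^sub>0)) * ((-1) ^ card I\<^sub>0 * of_int (V I\<^sub>0) * w (- E I\<^sub>0))"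
      using w_add[of "E I\<^sub>0" "- E I\<^sub>0"] by (simp add: w_0 mult_ac flip: power_mult_distrib)
    also have "\<dots> = of_nat p * R"
      unfolding eq R_def w_power[symmetric] diff_conv_add_uminus w_add
      by (simp add: sum_distrib_left sum_negf mult_ac)
    finally show ?thesis .
  qed
  then have R: "R = of_int (V I\<^sub>0) / of_int (int p)"
    using p0 by (simp add: field_simps)
  then have "R \<in> \<rat>"
    by simp
  ultimately have "R \<in> \<int>"
    by (rule rational_algebraic_int_is_int)
  then have "int p dvd V I\<^sub>0"
    using \<open>of_int (V I\<^sub>0) = of_nat p * R\<close>
    by (elim Ints_cases) (metis dvd_triv_left of_int_eq_iff of_int_mult of_int_of_nat_eq)
  with V0 show False by simp
qed

subsection \<open>Invariant factors of finite abelian \<open>p\<close>-groups\<close>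

lemma (in group) nat_pow_int_pow:
  assumes "x \<in> carrier G"
  shows "(x [^] (i::int)) [^] (k::nat) = x [^] (i * int k)"
  using int_pow_pow[OF assms, of i "int k"] by (simp only: int_pow_int)

text \<open>The complement is a maximal subgroup \<open>H\<close> meeting \<open>\<langle>x\<rangle>\<close> trivially: if \<open>y \<notin> H\<langle>x\<rangle>\<close> but
  \<open>y\<^sup>p = h x\<^sup>l\<close>, then \<open>p\<close> divides \<open>l\<close> because \<open>x\<close> has maximal order, and \<open>H\<close> can be enlarged by
  \<open>y x\<^sup>-\<^sup>l\<^sup>/\<^sup>p\<close>.\<close>

lemma (in comm_group) maximal_order_element_complement:
  assumes p: "Factorial_Ring.prime p" and fin: "finite (carrier G)"
    and x: "x \<in> carrier G" "ord x = p ^ a" "\<And>y. y \<in> carrier G \<Longrightarrow> y [^] (p ^ a) = \<one>"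
  obtains H where "subgroup H G" "H \<inter> range (\<lambda>i::int. x [^] i) \<subseteq> {\<one>}"
    "H <#> range (\<lambda>i::int. x [^] i) = carrier G"
proof -
  define P where "P = range (\<lambda>i::int. x [^] i)"
  have P: "subgroup P G"
    unfolding P_def using x(1) by (rule subgroup_of_powers)
  define \<S> where "\<S> = {H. subgroup H G \<and> H \<inter> P \<subseteq> {\<one>}}"
  have "\<S> \<subseteq> Pow (carrier G)"
    by (auto simp: \<S>_def dest: subgroup.subset)
  moreover have "{\<one>} \<in> \<S>"
    by (simp add: \<S>_def triv_subgroup)
  ultimately obtain H where "H \<in> \<S>" and max: "\<And>H'. H' \<in> \<S> \<Longrightarrow> H \<subseteq> H' \<Longrightarrow> H = H'"
    using finite_has_maximal[of \<S>] fin by (metis empty_iff finite_Pow_iff finite_subset)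
  then have H: "subgroup H G" "H \<inter> P \<subseteq> {\<one>}"
    by (auto simp: \<S>_def)
  define K where "K = H <#> P"
  have K: "subgroup K G"
    unfolding K_def using H(1) P by (rule mult_subgroups)
  have HK: "H \<subseteq> K" and PK: "P \<subseteq> K"
    using H(1) P subgroup.one_closed[OF H(1)] subgroup.one_closed[OF P]
    by (force simp: K_def set_mult_def dest: subgroup.mem_carrier)+
  have "carrier G \<subseteq> K"
  proof (rule ccontr)
    assume "\<not> carrier G \<subseteq> K"
    then obtain y0 where y0: "y0 \<in> carrier G" "y0 \<notin> K" by auto
    \<comment> \<open>At the least \<open>j\<close>, the element
      \<open>y = y0 [^] (p ^ (j - 1))\<close> lies outside \<open>K\<close> while its
      \<open>p\<close>-th power lies in \<open>K\<close>.\<close>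
    define j where "j = (LEAST j. y0 [^] (p ^ j) \<in> K)"
    have ex: "y0 [^] (p ^ a) \<in> K"
      using x(3)[OF y0(1)] K by (simp add: subgroup.one_closed)
    then have j: "y0 [^] (p ^ j) \<in> K"
      unfolding j_def by (rule LeastI)
    then have "j \<noteq> 0"
      using y0 by (metis nat_pow_eone power_0)
    then obtain i where i: "j = Suc i"
      using not0_implies_Suc by blast
    define y where "y = y0 [^] (p ^ i)"
    have yc: "y \<in> carrier G"
      using y0 by (simp add: y_def)
    have yK: "y \<notin> K"
      unfolding y_def using i not_less_Least[of i "\<lambda>j. y0 [^] (p ^ j) \<in> K"] by (simp add: j_def)
    have "y [^] p \<in> K"
      using j y0(1) by (simp add: y_def i nat_pow_pow mult.commute)
    then obtain h l where hl: "h \<in> H" "y [^] p = h \<otimes> x [^] (l::int)"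
      by (auto simp: K_def P_def set_mult_def)
    have hc: "h \<in> carrier G"
      using hl(1) H(1) by (rule subgroup.mem_carrier[rotated])
    have "a \<noteq> 0"
      using x(3)[OF yc] yK yc K by (metis nat_pow_eone power_0 subgroup.one_closed)
    then obtain b where b: "a = Suc b"
      using not0_implies_Suc by blast
    \<comment> \<open>Raising \<open>y [^] p = h \<otimes> x [^] l\<close> to the power
      \<open>p ^ b\<close> puts \<open>x [^] (l * p ^ b)\<close> into \<open>H \<inter> P\<close>;
      the order \<open>p ^ a = p * p ^ b\<close> of \<open>x\<close> then forces \<open>p\<close> to
      divide \<open>l\<close>.\<close>
    have "\<one> = (y [^] p) [^] (p ^ b)"
      using x(3)[OF yc] yc by (simp add: nat_pow_pow b)
    also have "\<dots> = h [^] (p ^ b) \<otimes> x [^] (l * int (p ^ b))"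
      unfolding hl(2) using hc x(1) by (simp add: nat_pow_distrib nat_pow_int_pow)
    finally have "x [^] (l * int (p ^ b)) = inv (h [^] (p ^ b))"
      using hc x(1) by (metis int_pow_closed inv_equality inv_inv nat_pow_closed inv_closed)
    moreover have "inv (h [^] (p ^ b)) \<in> H"
      using H(1) hl(1) by (metis int_pow_int subgroup.m_inv_closed subgroup_int_pow_closed)
    moreover have "x [^] (l * int (p ^ b)) \<in> P"
      unfolding P_def by (rule rangeI)
    ultimately have "x [^] (l * int (p ^ b)) \<in> H \<inter> P"
      by simp
    then have "x [^] (l * int (p ^ b)) = \<one>"
      using H(2) by blast
    then have "int (p ^ a) dvd l * int (p ^ b)"
      using x by (simp add: int_pow_eq_id)
    then have "int p dvd l"
      using p by (simp add: b prime_gt_0_nat)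
    then obtain l' where l': "l = int p * l'" by auto
    define z where "z = y \<otimes> x [^] (- l')"
    have zc: "z \<in> carrier G"
      using yc x(1) by (simp add: z_def)
    have "z [^] p = y [^] p \<otimes> x [^] (- l)"
      using yc x(1) by (simp add: z_def l' nat_pow_distrib nat_pow_int_pow mult.commute)
    then have zp: "z [^] p = h"
      using hc x(1) by (simp add: hl(2) m_assoc flip: int_pow_mult)
    have "y = z \<otimes> x [^] l'"
      using yc x(1) by (simp add: z_def m_assoc flip: int_pow_mult)
    moreover have "x [^] l' \<in> K"
      using PK by (auto simp: P_def)
    ultimately have zK: "z \<notin> K"
      using yK K by (auto intro: subgroup.m_closed)
    define Z where "Z = range (\<lambda>i::int. z [^] i)"
    have Z: "subgroup Z G"
      unfolding Z_def using zc by (rule subgroup_of_powers)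
    define H' where "H' = H <#> Z"
    have H': "subgroup H' G"
      unfolding H'_def using H(1) Z by (rule mult_subgroups)
    have "H \<subseteq> H'" and ZH': "Z \<subseteq> H'"
      using H(1) Z subgroup.one_closed[OF H(1)] subgroup.one_closed[OF Z]
      by (force simp: H'_def set_mult_def dest: subgroup.mem_carrier)+
    \<comment> \<open>For \<open>w = h1 \<otimes> z [^] i\<close> in \<open>P\<close>, also
      \<open>z [^] i\<close> lies in \<open>K\<close>. So does \<open>z [^] p = h\<close>, and
      Bezout would give \<open>z \<in> K\<close> if \<open>i\<close> were prime to \<open>p\<close>.
      Hence \<open>z [^] i\<close> is a power of \<open>h\<close>, and \<open>w\<close> lies in
      \<open>H \<inter> P\<close>.\<close>
    moreover have "H' \<inter> P \<subseteq> {\<one>}"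
    proof
      fix w assume w: "w \<in> H' \<inter> P"
      then obtain h1 i where h1: "h1 \<in> H" "w = h1 \<otimes> z [^] (i::int)"
        by (auto simp: H'_def Z_def set_mult_def)
      have h1c: "h1 \<in> carrier G"
        using h1(1) H(1) by (rule subgroup.mem_carrier[rotated])
      have "int p dvd i"
      proof (rule ccontr)
        assume "\<not> int p dvd i"
        then have "Rings.coprime (int p) i"
          using p by (simp add: prime_imp_coprime)
        then obtain u v where uv: "u * int p + v * i = 1"
          using bezout_int[of "int p" i] by (auto simp: coprime_iff_gcd_eq_1)
        have "z [^] i = inv h1 \<otimes> w"
          using h1c zc by (simp add: h1(2) flip: m_assoc)
        also have "\<dots> \<in> K"
          using HK PK h1(1) w K by (auto intro!: subgroup.m_closed subgroup.m_inv_closed)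
        finally have "(z [^] i) [^] v \<in> K"
          using K by (rule subgroup_int_pow_closed[rotated])
        moreover have "z [^] int p \<in> K"
          unfolding int_pow_int zp using HK hl(1) by auto
        then have "(z [^] int p) [^] u \<in> K"
          using K by (rule subgroup_int_pow_closed[rotated])
        ultimately have "(z [^] int p) [^] u \<otimes> (z [^] i) [^] v \<in> K"
          using K by (auto intro: subgroup.m_closed)
        also have "(z [^] int p) [^] u \<otimes> (z [^] i) [^] v = z [^] (u * int p + v * i)"
          using zc by (simp add: int_pow_pow int_pow_mult mult.commute)
        finally show False
          using zK zc uv by simp
      qed
      then obtain i' where "i = int p * i'" by auto
      then have "z [^] i = h [^] i'"
        using zc zp by (simp add: int_pow_int flip: int_pow_pow)
      then have "w \<in> H"
        using H(1) h1 hl(1) by (auto intro: subgroup.m_closed subgroup_int_pow_closed)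
      then show "w \<in> {\<one>}"
        using w H(2) by auto
    qed
    ultimately have "H = H'"
      using H' by (intro max) (auto simp: \<S>_def)
    moreover have "z \<in> Z"
      unfolding Z_def using zc by (metis int_pow_1 rangeI)
    ultimately show False
      using ZH' HK zK by auto
  qed
  then have "K = carrier G"
    using K subgroup.subset by blast
  then show thesis
    using that H unfolding K_def P_def by blast
qed

lemma (in group) integer_mod_group_iso_powers:
  assumes x: "x \<in> carrier G" "ord x > 0"
  shows "integer_mod_group (ord x) \<cong> subgroup_generated G (range (\<lambda>i::int. x [^] i))"
proof -
  let ?P = "range (\<lambda>i::int. x [^] i)"
  interpret P: subgroup ?P G
    using x(1) by (rule subgroup_of_powers)
  have mod: "x [^] (i mod int (ord x)) = x [^] i" for i :: int
    using x(1) by (simp add: int_pow_eq)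
  have "(\<lambda>i::int. x [^] i) \<in> iso (integer_mod_group (ord x)) (subgroup_generated G ?P)"
  proof (rule isoI)
    show "(\<lambda>i::int. x [^] i) \<in> hom (integer_mod_group (ord x)) (subgroup_generated G ?P)"
      using x by (auto simp: hom_def mod int_pow_mult)
    show "bij_betw (\<lambda>i::int. x [^] i) (carrier (integer_mod_group (ord x))) (carrier (subgroup_generated G ?P))"
      unfolding bij_betw_def
    proof
      show "inj_on (\<lambda>i::int. x [^] i) (carrier (integer_mod_group (ord x)))"
      proof (rule inj_onI)
        fix i j assume "i \<in> carrier (integer_mod_group (ord x))" "j \<in> carrier (integer_mod_group (ord x))"
          and "x [^] i = x [^] j"
        then have "int (ord x) dvd j - i" "0 \<le> i" "i < int (ord x)" "0 \<le> j" "j < int (ord x)"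
          using x by (auto simp: int_pow_eq carrier_integer_mod_group)
        then show "i = j"
          by (metis mod_eq_dvd_iff mod_pos_pos_trivial)
      qed
      show "(\<lambda>i::int. x [^] i) ` carrier (integer_mod_group (ord x)) = carrier (subgroup_generated G ?P)"
      proof safe
        fix i :: int
        show "x [^] i \<in> carrier (subgroup_generated G ?P)"
          by simp
      next
        fix y assume "y \<in> carrier (subgroup_generated G ?P)"
        then obtain i :: int where "y = x [^] i"
          by auto
        then have "y = x [^] (i mod int (ord x))"
          by (simp add: mod)
        then show "y \<in> (\<lambda>i::int. x [^] i) ` carrier (integer_mod_group (ord x))"
          using x(2) by (auto simp: carrier_integer_mod_group)
      qed
    qed
  qed
  then show ?thesis
    by (rule is_isoI)
qed

text \<open>Splits off the last coordinate. \<open>F'\<close> is only tied to \<open>F\<close> below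
  \<open>r\<close>, so that it can come from a list with one entry appended.\<close>

lemma sum_group_lessThan_Suc_iso:
  assumes "\<And>i. i < r \<Longrightarrow> group (F i)" "group K" "\<And>i. i < r \<Longrightarrow> F' i = F i" "F' r = K"
  shows "sum_group {..<Suc r} F' \<cong> sum_group {..<r} F \<times>\<times> K"
proof -
  have F': "group (F' i)" if "i < Suc r" for i
    using assms that by (cases "i = r") auto
  have c1: "carrier (sum_group {..<Suc r} F') = (\<Pi>\<^sub>E i\<in>{..<Suc r}. carrier (F' i))"
    using F' by (subst carrier_sum_group) auto
  have c2: "carrier (sum_group {..<r} F) = (\<Pi>\<^sub>E i\<in>{..<r}. carrier (F i))"
    using assms by (subst carrier_sum_group) auto
  have "(\<lambda>f. (restrict f {..<r}, f r)) \<in> iso (sum_group {..<Suc r} F') (sum_group {..<r} F \<times>\<times> K)"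
  proof (rule isoI)
    show "(\<lambda>f. (restrict f {..<r}, f r)) \<in> hom (sum_group {..<Suc r} F') (sum_group {..<r} F \<times>\<times> K)"
    proof (rule homI)
      fix f g assume "f \<in> carrier (sum_group {..<Suc r} F')" "g \<in> carrier (sum_group {..<Suc r} F')"
      show "(restrict (f \<otimes>\<^bsub>sum_group {..<Suc r} F'\<^esub> g) {..<r}, (f \<otimes>\<^bsub>sum_group {..<Suc r} F'\<^esub> g) r) =
         (restrict f {..<r}, f r) \<otimes>\<^bsub>sum_group {..<r} F \<times>\<times> K\<^esub> (restrict g {..<r}, g r)"
        using assms by (auto intro!: ext simp: restrict_def)
    next
      fix f assume "f \<in> carrier (sum_group {..<Suc r} F')"
      then have f: "f i \<in> carrier (F' i)" if "i < Suc r" for i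
        using that unfolding c1 by auto
      show "(restrict f {..<r}, f r) \<in> carrier (sum_group {..<r} F \<times>\<times> K)"
        unfolding carrier_DirProd c2 using f[of r] f assms(3,4)
        by (auto simp: restrict_PiE_iff) (metis less_SucI)
    qed
    show "bij_betw (\<lambda>f. (restrict f {..<r}, f r)) (carrier (sum_group {..<Suc r} F')) (carrier (sum_group {..<r} F \<times>\<times> K))"
      unfolding carrier_DirProd c1 c2
    proof (rule bij_betwI[where g = "\<lambda>(f, x). f(r := x)"], goal_cases)
      case 1
      show ?case
      proof
        fix f assume "f \<in> (\<Pi>\<^sub>E i\<in>{..<Suc r}. carrier (F' i))"
        then have f: "f i \<in> carrier (F' i)" if "i < Suc r" for i
          using that by auto
        show "(restrict f {..<r}, f r) \<in> (\<Pi>\<^sub>E i\<in>{..<r}. carrier (F i)) \<times> carrier K"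
          using f[of r] f assms(3,4) by (auto simp: restrict_PiE_iff) (metis less_SucI)
      qed
    next
      case 2
      show ?case using assms by (auto simp: PiE_iff extensional_def less_Suc_eq)
    next
      case (3 f)
      then show ?case by (auto simp: PiE_iff extensional_def fun_eq_iff restrict_def)
    next
      case (4 y)
      obtain g k where y: "y = (g, k)"
        by (cases y)
      have "restrict (g(r := k)) {..<r} = restrict g {..<r}"
        by (auto simp: restrict_def)
      also have "\<dots> = g"
        using 4 unfolding y by (blast intro: PiE_restrict)
      finally show ?case
        by (simp add: y)
    qed
  qed
  then show ?thesis
    by (rule is_isoI)
qed

text \<open>The \<open>q\<close>-th power of the vector with all coordinates 1 has the coordinates
  \<open>q mod d\<close>, which must vanish. This lets a new largest factor end the divisibility
  chain, and shows that the factors of a \<open>p\<close>-group are powers of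
  \<open>p\<close>.\<close>

lemma invariant_factors_dvd_exponent:
  assumes "group G" and ds: "invariant_factors G ds" and q: "\<And>y. y \<in> carrier G \<Longrightarrow> y [^]\<^bsub>G\<^esub> (q::nat) = \<one>\<^bsub>G\<^esub>"
    and d: "d \<in> set ds"
  shows "d dvd q"
proof -
  interpret group G by fact
  let ?S = "sum_group {..<length ds} (\<lambda>i. integer_mod_group (ds ! i))"
  interpret S: group ?S
    by (intro sum_group) simp
  have "?S \<cong> G"
    using ds by (auto simp: invariant_factors_def intro: iso_sym)
  then obtain f where f: "f \<in> iso ?S G"
    by (auto simp: is_iso_def)
  then have hom: "f \<in> hom ?S G" and inj: "inj_on f (carrier ?S)"
    by (auto simp: iso_def bij_betw_def)
  have pow: "u [^]\<^bsub>?S\<^esub> k = (\<lambda>i\<in>{..<length ds}. (int k * u i) mod int (ds ! i))" for u and k :: nat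
    by (induction k) (auto simp: fun_eq_iff algebra_simps mod_simps)
  define u where "u = (\<lambda>i\<in>{..<length ds}. 1::int)"
  have u: "u \<in> carrier ?S"
    using ds by (auto simp: carrier_sum_group u_def invariant_factors_def carrier_integer_mod_group)
  have "f (u [^]\<^bsub>?S\<^esub> q) = f u [^]\<^bsub>G\<^esub> q"
    using hom u S.is_group is_group by (rule hom_nat_pow)
  also have "\<dots> = \<one>\<^bsub>G\<^esub>"
    using hom u by (intro q) (auto simp: hom_def)
  also have "\<dots> = f \<one>\<^bsub>?S\<^esub>"
    using hom_one[OF hom] by (simp add: S.is_group is_group)
  finally have eq: "u [^]\<^bsub>?S\<^esub> q = \<one>\<^bsub>?S\<^esub>"
    by (rule inj_onD[OF inj _ S.nat_pow_closed[OF u] S.one_closed])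
  obtain i where i: "i < length ds" "d = ds ! i"
    using d by (auto simp: in_set_conv_nth)
  have "(u [^]\<^bsub>?S\<^esub> q) i = \<one>\<^bsub>?S\<^esub> i"
    by (simp only: eq)
  then have "int q mod int d = 0"
    using i unfolding pow by (simp add: u_def)
  then show ?thesis
    by (metis dvd_eq_mod_eq_0 int_dvd_int_iff)
qed

text \<open>Orders in a \<open>p\<close>-group are powers of \<open>p\<close>, so the largest order
  \<open>p ^ a\<close> annihilates the whole group. The cyclic group of an element of that order has
  a complement whose factors divide \<open>p ^ a\<close>, and \<open>p ^ a\<close> goes to the end
  of their list.\<close>

lemma (in comm_group) invariant_factors_exist_step:
  assumes p: "Factorial_Ring.prime p" and fin: "finite (carrier G)" and e: "Coset.order G = p ^ e"
    and nontriv: "carrier G \<noteq> {\<one>}"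
    and IH: "\<And>H. subgroup H G \<Longrightarrow> H \<subset> carrier G \<Longrightarrow> \<exists>ds. invariant_factors (subgroup_generated G H) ds"
  shows "\<exists>ds. invariant_factors G ds"
proof -
  have ord_dvd: "ord y dvd p ^ e" if "y \<in> carrier G" for y
    using ord_dvd_group_order[OF that] by (simp add: e)
  have "finite (ord ` carrier G)" "ord ` carrier G \<noteq> {}"
    using fin by auto
  then obtain x where x: "x \<in> carrier G" and max: "\<And>y. y \<in> carrier G \<Longrightarrow> ord y \<le> ord x"
    by (metis (no_types, lifting) Max_ge Max_in image_iff imageI)
  obtain a where a: "ord x = p ^ a"
    using ord_dvd[OF x] p divides_primepow_nat by blast
  have x_exp: "y [^] (p ^ a) = \<one>" if y: "y \<in> carrier G" for y
  proof -
    obtain b where b: "ord y = p ^ b"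
      using ord_dvd[OF y] p divides_primepow_nat by blast
    have "b \<le> a"
      using max[OF y] p prime_gt_1_nat by (simp add: a b power_increasing_iff)
    then show ?thesis
      using y by (simp add: pow_eq_id b le_imp_power_dvd)
  qed
  have "x \<noteq> \<one>"
  proof
    assume "x = \<one>"
    have "y = \<one>" if "y \<in> carrier G" for y
    proof -
      have "ord y = 1"
        using max[OF that] ord_ge_1[OF fin that] unfolding \<open>x = \<one>\<close> by simp
      then show ?thesis
        using ord_eq_1[OF that] by simp
    qed
    then show False
      using nontriv by blast
  qed
  then have "p ^ a \<noteq> 1"
    using ord_eq_1[OF x] a by simp
  then have a1: "1 < p ^ a"
    using p prime_gt_0_nat by (metis One_nat_def Suc_lessI zero_less_power)
  let ?P = "range (\<lambda>i::int. x [^] i)"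
  obtain H where H: "subgroup H G" "H \<inter> ?P \<subseteq> {\<one>}" "H <#> ?P = carrier G"
    using maximal_order_element_complement[OF p fin x a x_exp] by blast
  have P: "subgroup ?P G"
    using x by (rule subgroup_of_powers)
  interpret sum: group_disjoint_sum G H ?P
    using H(1) P by (simp add: group_disjoint_sum_def is_group)
  let ?H = "subgroup_generated G H"
  have cH: "carrier ?H = H"
    using H(1) by (rule subgroup.carrier_subgroup_generated_subgroup)
  have "x \<in> ?P"
    by (metis int_pow_1 rangeI x)
  then have "x \<notin> H"
    using H(2) \<open>x \<noteq> \<one>\<close> by blast
  then have "H \<subset> carrier G"
    using x subgroup.subset[OF H(1)] by blast
  then obtain ds where ds: "invariant_factors ?H ds"
    using IH[OF H(1)] by blast
  have dvd: "d dvd p ^ a" if "d \<in> set ds" for d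
  proof (rule invariant_factors_dvd_exponent[OF _ ds _ that])
    show "y [^]\<^bsub>?H\<^esub> (p ^ a) = \<one>\<^bsub>?H\<^esub>" if "y \<in> carrier ?H" for y
      using that H(1) x_exp by (simp add: pow_subgroup_generated cH subgroup.mem_carrier)
  qed simp
  have "(\<lambda>(x, y). x \<otimes> y) \<in> iso (?H \<times>\<times> subgroup_generated G ?P) G"
    using sum.iso_group_mul[OF comm_group_axioms] H by simp
  then have "?H \<times>\<times> subgroup_generated G ?P \<cong> G"
    by (rule is_isoI)
  then have "G \<cong> ?H \<times>\<times> subgroup_generated G ?P"
    by (rule group.iso_sym[rotated]) (simp add: DirProd_group)
  also have "\<dots> \<cong> sum_group {..<length ds} (\<lambda>i. integer_mod_group (ds ! i)) \<times>\<times> integer_mod_group (p ^ a)"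
  proof (rule group.DirProd_iso_trans)
    show "?H \<cong> sum_group {..<length ds} (\<lambda>i. integer_mod_group (ds ! i))"
      using ds by (simp add: invariant_factors_def)
    show "subgroup_generated G ?P \<cong> integer_mod_group (p ^ a)"
      unfolding a[symmetric] using a a1 x
      by (intro group.iso_sym[OF group_integer_mod_group] integer_mod_group_iso_powers) linarith+
  qed simp
  also have "\<dots> \<cong> sum_group {..<Suc (length ds)} (\<lambda>i. integer_mod_group ((ds @ [p ^ a]) ! i))"
    by (rule group.iso_sym[OF _ sum_group_lessThan_Suc_iso]) (simp_all add: nth_append)
  finally have "G \<cong> sum_group {..<length (ds @ [p ^ a])} (\<lambda>i. integer_mod_group ((ds @ [p ^ a]) ! i))"
    by simp
  moreover have "ds = [] \<or> last ds dvd p ^ a"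
    using dvd last_in_set by blast
  ultimately have "invariant_factors G (ds @ [p ^ a])"
    using ds a1 by (auto simp: invariant_factors_def successively_append_iff)
  then show ?thesis by blast
qed

lemma invariant_factors_exist:
  fixes G :: "('a, 'b) monoid_scheme"
  assumes p: "Factorial_Ring.prime p" and G: "finite_abelian_p_group p G"
  shows "\<exists>ds. invariant_factors G ds"
  using G
proof (induction "card (carrier G)" arbitrary: G rule: less_induct)
  case less
  then interpret comm_group G
    by (simp add: finite_abelian_p_group_def)
  obtain e where fin: "finite (carrier G)" and e: "Coset.order G = p ^ e"
    using less.prems by (auto simp: finite_abelian_p_group_def)
  show ?case
  proof (cases "carrier G = {\<one>\<^bsub>G\<^esub>}")
    case True
    let ?S = "sum_group {..<0::nat} (\<lambda>i. integer_mod_group ([] ! i))"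
    \<comment> \<open>The direct sum over no index has the single element
      \<open>\<lambda>_. undefined\<close>; the empty list thus serves the trivial group.\<close>
    have "(\<lambda>_ _. undefined) \<in> iso G ?S"
      using True by (auto simp: iso_def hom_def bij_betw_def carrier_sum_group restrict_def)
    then have "G \<cong> ?S"
      by (rule is_isoI)
    then show ?thesis
      by (intro exI[of _ "[]"]) (simp add: invariant_factors_def)
  next
    case False
    show ?thesis
    proof (rule invariant_factors_exist_step[OF p fin e False])
      fix H assume H: "subgroup H G" "H \<subset> carrier G"
      let ?H = "subgroup_generated G H"
      have cH: "carrier ?H = H"
        using H(1) by (rule subgroup.carrier_subgroup_generated_subgroup)
      have "card H dvd p ^ e"
        using lagrange[OF H(1)] by (metis dvd_triv_right e)
      then have "finite_abelian_p_group p ?H"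
        using p divides_primepow_nat abelian_subgroup_generated[OF comm_group_axioms]
          finite_subset[OF psubset_imp_subset[OF H(2)] fin]
        by (auto simp: finite_abelian_p_group_def Coset.order_def cH)
      moreover have "card (carrier ?H) < card (carrier G)"
        unfolding cH using fin H(2) by (rule psubset_card_mono)
      ultimately show "\<exists>ds. invariant_factors ?H ds"
        using less.hyps by blast
    qed
  qed
qed

text \<open>For an injective \<open>\<phi>\<close> this turns equality of two sums in
  \<open>G\<close> into integer congruences, one modulo each \<open>d i\<close>.\<close>

lemma hom_sum_group_integer_mod_finprod:
  assumes "comm_group G"
    and \<phi>: "\<phi> \<in> hom G (sum_group {..<r} (\<lambda>i. integer_mod_group (d i)))"
    and "finite I" "\<And>s. s \<in> I \<Longrightarrow> c s \<in> carrier G"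
  shows "\<phi> (finprod G c I) = (\<lambda>i\<in>{..<r}. (\<Sum>s\<in>I. \<phi> (c s) i) mod int (d i))"
  using assms(3,4)
proof (induction I rule: finite_induct)
  case empty
  interpret comm_group G by fact
  have "\<phi> \<one>\<^bsub>G\<^esub> = \<one>\<^bsub>sum_group {..<r} (\<lambda>i. integer_mod_group (d i))\<^esub>"
    using \<phi> by (rule hom_one) (simp_all add: is_group)
  then show ?case
    by (simp add: restrict_def)
next
  case (insert s I)
  interpret comm_group G by fact
  have "\<phi> (finprod G c (insert s I)) = (\<lambda>i\<in>{..<r}. (\<phi> (c s) i + \<phi> (finprod G c I) i) mod int (d i))"
    using insert \<phi> by (simp add: Pi_def hom_mult)
  also have "\<dots> = (\<lambda>i\<in>{..<r}. (\<Sum>s\<in>insert s I. \<phi> (c s) i) mod int (d i))"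
    using insert by (auto simp: restrict_def mod_simps)
  finally show ?case .
qed

text \<open>Existence of a list makes the \<open>SOME\<close> in \<open>d_star\<close> a valid
  choice; each entry divides the group order and so is a power of \<open>p\<close>.\<close>

lemma d_star_eq_sum_invariant_factors:
  assumes p: "Factorial_Ring.prime p" and G: "finite_abelian_p_group p G"
  obtains ds where "invariant_factors G ds" "d_star G = (\<Sum>d\<leftarrow>ds. d - 1)"
    "\<And>d. d \<in> set ds \<Longrightarrow> \<exists>b. d = p ^ b"
proof -
  interpret comm_group G
    using G by (simp add: finite_abelian_p_group_def)
  obtain e where e: "Coset.order G = p ^ e"
    using G by (auto simp: finite_abelian_p_group_def)
  have dvd: "d dvd Coset.order G" if "invariant_factors G ds" "d \<in> set ds" for d ds
    using invariant_factors_dvd_exponent[OF is_group that(1) pow_order_eq_1 that(2)] .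
  define ds where "ds = (SOME ds. invariant_factors G ds)"
  have ds: "invariant_factors G ds"
    unfolding ds_def using invariant_factors_exist[OF p G] by (rule someI_ex)
  \<comment> \<open>The value 0 that \<open>d_star\<close> is given on the trivial group agrees with
    the sum: entries exceed 1 and divide the order 1, so the list is empty.\<close>
  have "ds = []" if "Coset.order G = 1"
    using dvd[OF ds] ds that by (cases ds) (auto simp: invariant_factors_def)
  then have "d_star G = (\<Sum>d\<leftarrow>ds. d - 1)"
    by (auto simp: d_star_def ds_def[symmetric])
  then show thesis
    using that ds dvd[OF ds] p divides_primepow_nat unfolding e by blast
qed

subsection \<open>Zero-sum problems and covers\<close>

lemma subset_with_same_sums:
  fixes p h k :: nat
    and G :: "('a, 'b) monoid_scheme"
    and a n m :: "nat \<Rightarrow> int"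
    and c :: "nat \<Rightarrow> 'a"
  assumes p: "Factorial_Ring.prime p"
    and G: "finite_abelian_p_group p G"
    and n: "\<forall>s \<in> {1..k}. n s > 0"
    and cover: "is_m_cover (d_star G + p ^ h) k a n"
    and c: "\<forall>s \<in> {1..k}. c s \<in> carrier G"
    and J: "J \<subseteq> {1..k}"
  obtains I t where "I \<subseteq> {1..k}" "I \<noteq> J" "finprod G c I = finprod G c J"
    "(\<Sum>s\<in>I. of_int (m s) / of_int (n s) :: rat) =
     (\<Sum>s\<in>J. of_int (m s) / of_int (n s)) + of_nat (p ^ h) * of_int t"
proof -
  interpret comm_group G
    using G by (simp add: finite_abelian_p_group_def)
  obtain ds where ds: "invariant_factors G ds" and d_star: "d_star G = (\<Sum>d\<leftarrow>ds. d - 1)"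
    and pow: "\<And>d. d \<in> set ds \<Longrightarrow> \<exists>b. d = p ^ b"
    using d_star_eq_sum_invariant_factors[OF p G] by blast
  define r where "r = length ds"
  have "\<exists>b. ds ! i = p ^ b" if "i < r" for i
    using that by (intro pow) (simp add: r_def)
  then obtain b where b: "\<And>i. i < r \<Longrightarrow> ds ! i = p ^ b i"
    by metis
  obtain \<phi> where \<phi>: "\<phi> \<in> iso G (sum_group {..<r} (\<lambda>i. integer_mod_group (ds ! i)))"
    using ds by (auto simp: invariant_factors_def is_iso_def r_def)
  \<comment> \<open>The indices below \<open>r\<close> stand for the invariant factors, read off as
    coordinates under \<open>\<phi>\<close>; index \<open>r\<close> stands for the sum of fractions,
    tested modulo \<open>p ^ h\<close>.\<close>
  define e where "e i = (if i < r then b i else h)" for i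
  define U where "U i s = (if i < r then of_int (\<phi> (c s) i) else of_int (m s) / of_int (n s) :: complex)" for i s
  have cover': "(\<Sum>i\<in>{..r}. p ^ e i - 1) < card {s\<in>{1..k}. n s dvd x - a s}" for x
  proof -
    have "(\<Sum>i\<in>{..r}. p ^ e i - 1) = (\<Sum>i<r. ds ! i - 1) + (p ^ h - 1)"
      by (simp add: e_def b flip: lessThan_Suc_atMost)
    also have "(\<Sum>i<r. ds ! i - 1) = d_star G"
      by (simp add: d_star r_def sum_list_sum_nth atLeast0LessThan)
    also have "d_star G + (p ^ h - 1) < d_star G + p ^ h"
      using p by (simp add: prime_gt_0_nat)
    also have "\<dots> \<le> covering_function k a n x"
      using cover by (simp add: is_m_cover_def)
    also have "{s\<in>{1..k}. x \<in> residue_class (a s) (n s)} = {s\<in>{1..k}. n s dvd x - a s}"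
      by (auto simp: residue_class_def dvd_def algebra_simps)
    then have "covering_function k a n x = card {s\<in>{1..k}. n s dvd x - a s}"
      by (simp add: covering_function_def)
    finally show ?thesis .
  qed
  have ints: "sum (U i) I - sum (U i) J \<in> \<int>"
    if "(\<Sum>s\<in>I. of_int (m s) / of_int (n s)) - (\<Sum>s\<in>J. of_int (m s) / of_int (n s)) \<in> (\<int> :: complex set)" for I i
    using that by (cases "i < r") (simp_all add: U_def Ints_diff Ints_sum)
  obtain I where I: "I \<subseteq> {1..k}" "I \<noteq> J"
    and div: "\<And>i. i \<in> {..r} \<Longrightarrow> (sum (U i) I - sum (U i) J) / of_nat (p ^ e i) \<in> \<int>"
    by (rule subset_sum_not_unique[OF p _ _ _ cover' J, of m U]) (use n ints in auto)

  have fin: "finite I" "finite J"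
    using I(1) J finite_subset by blast+
  have cI: "\<And>s. s \<in> I \<Longrightarrow> c s \<in> carrier G" and cJ: "\<And>s. s \<in> J \<Longrightarrow> c s \<in> carrier G"
    using c I(1) J by auto
  have q0: "p ^ j \<noteq> 0" for j
    using p by (simp add: prime_gt_0_nat)
  have "int (ds ! i) dvd (\<Sum>s\<in>I. \<phi> (c s) i) - (\<Sum>s\<in>J. \<phi> (c s) i)" if i: "i < r" for i
  proof -
    have "(of_int ((\<Sum>s\<in>I. \<phi> (c s) i) - (\<Sum>s\<in>J. \<phi> (c s) i)) / of_int (int (ds ! i)) :: complex) \<in> \<int>"
      using div[of i] i by (simp add: U_def e_def b)
    then show ?thesis
      unfolding of_int_div_of_int_in_Ints_iff using q0 b[OF i] by auto
  qed
  moreover have hom: "\<phi> \<in> hom G (sum_group {..<r} (\<lambda>i. integer_mod_group (ds ! i)))"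
    and inj: "inj_on \<phi> (carrier G)"
    using \<phi> by (auto simp: iso_def bij_betw_def)
  ultimately have "\<phi> (finprod G c I) = \<phi> (finprod G c J)"
    using hom_sum_group_integer_mod_finprod[OF comm_group_axioms hom fin(1) cI]
      hom_sum_group_integer_mod_finprod[OF comm_group_axioms hom fin(2) cJ]
    by (auto simp: restrict_def mod_eq_dvd_iff)
  then have prod: "finprod G c I = finprod G c J"
    using cI cJ by (intro inj_onD[OF inj]) auto
  define \<beta> :: rat where "\<beta> = (\<Sum>s\<in>I. of_int (m s) / of_int (n s)) - (\<Sum>s\<in>J. of_int (m s) / of_int (n s))"
  have "(of_rat (\<beta> / of_nat (p ^ h)) :: complex) \<in> \<int>"
    using div[of r] by (simp add: \<beta>_def U_def e_def of_rat_divide of_rat_diff of_rat_sum of_rat_power)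
  then obtain t where "(of_rat (\<beta> / of_nat (p ^ h)) :: complex) = of_rat (of_int t)"
    by (auto elim: Ints_cases)
  then have "\<beta> / of_nat (p ^ h) = of_int t"
    by (simp only: of_rat_eq_iff)
  then have "\<beta> = of_nat (p ^ h) * of_int t"
    using q0[of h] by (simp add: field_simps)
  then show thesis
    using that[OF I prod, of t] by (simp add: \<beta>_def algebra_simps)
qed

theorem theorem2p1:
  fixes p h k :: nat
    and G :: "('a, 'b) monoid_scheme"
    and a n m :: "nat \<Rightarrow> int"
    and c :: "nat \<Rightarrow> 'a"
  assumes "Factorial_Ring.prime p"
    and "finite_abelian_p_group p G"
    and "\<forall>s \<in> {1..k}. n s > 0"
    and "is_m_cover (d_star G + p ^ h) k a n"
    and "\<forall>s \<in> {1..k}. c s \<in> carrier G"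
  shows "(\<forall>g \<in> carrier G. \<forall>\<alpha> :: rat.
            card {I. I \<subseteq> {1..k} \<and> finprod G c I = g \<and>
                     (\<Sum>s\<in>I. of_int (m s) / of_int (n s)) \<in> {\<alpha> + of_nat (p ^ h) * of_int t |t. True}} \<noteq> 1)
       \<and> (\<exists>I. I \<noteq> {} \<and> I \<subseteq> {1..k} \<and> finprod G c I = \<one>\<^bsub>G\<^esub> \<and>
            (\<Sum>s\<in>I. of_int (m s) / of_int (n s)) \<in> {of_nat (p ^ h) * of_int t :: rat |t. True})"
proof (intro conjI ballI allI)
  fix g and \<alpha> :: rat
  let ?A = "{I. I \<subseteq> {1..k} \<and> finprod G c I = g \<and>
    (\<Sum>s\<in>I. of_int (m s) / of_int (n s)) \<in> {\<alpha> + of_nat (p ^ h) * of_int t |t. True}}"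
  show "card ?A \<noteq> 1"
  proof
    assume "card ?A = 1"
    then obtain J where A: "?A = {J}"
      by (rule card_1_singletonE)
    then have "J \<in> ?A" by simp
    then obtain u where J: "J \<subseteq> {1..k}" "finprod G c J = g"
      "(\<Sum>s\<in>J. of_int (m s) / of_int (n s)) = \<alpha> + of_nat (p ^ h) * of_int u"
      by blast
    obtain I t where I: "I \<subseteq> {1..k}" "I \<noteq> J" "finprod G c I = finprod G c J"
      "(\<Sum>s\<in>I. of_int (m s) / of_int (n s) :: rat) =
       (\<Sum>s\<in>J. of_int (m s) / of_int (n s)) + of_nat (p ^ h) * of_int t"
      using subset_with_same_sums[OF assms J(1)] .
    have "(\<Sum>s\<in>I. of_int (m s) / of_int (n s)) = \<alpha> + of_nat (p ^ h) * of_int (u + t)"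
      unfolding I(4) J(3) by (simp add: algebra_simps)
    then have "I \<in> ?A"
      using I(1,3) J(2) by blast
    then show False
      using A I(2) by blast
  qed
next
  \<comment> \<open>Both sums over the empty set are zero, so a different index set with the same
    sums is the nonempty one sought.\<close>
  obtain I t where "I \<subseteq> {1..k}" "I \<noteq> {}" "finprod G c I = finprod G c {}"
    "(\<Sum>s\<in>I. of_int (m s) / of_int (n s) :: rat) =
     (\<Sum>s\<in>{}. of_int (m s) / of_int (n s)) + of_nat (p ^ h) * of_int t"
    using subset_with_same_sums[OF assms empty_subsetI] .
  then show "\<exists>I. I \<noteq> {} \<and> I \<subseteq> {1..k} \<and> finprod G c I = \<one>\<^bsub>G\<^esub> \<and>
      (\<Sum>s\<in>I. of_int (m s) / of_int (n s)) \<in> {of_nat (p ^ h) * of_int t :: rat |t. True}"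
    using assms(2) by (intro exI[of _ I]) (auto simp: finite_abelian_p_group_def comm_group_def comm_monoid.finprod_empty)
qed

end
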